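(* Let $r\ge 1$ and let $m\ge 2$ be even. Let $\mathcal{A}=\{e^{2\pi i j/2^r}:0\le j<2^r\}$ be the set of complex $2^r$-th roots of unity. Then there exist $N=|\mathcal{A}|^{m-2}=2^{(m-2)r}$ two-dimensional subspaces of $\mathbb{C}^m$, each generated by two vectors in $\mathcal{A}^m$, which pairwise intersect only in $\{0\}$. *)

theory Defs
  imports "HOL-Analysis.Analysis"
begin

definition pow2_roots :: "nat \<Rightarrow> complex set" where
  "pow2_roots r =
     {exp (2 * of_real pi * \<i> * of_nat j / 2 ^ r) | j :: nat. j < 2 ^ r}"

(* Subspaces, spans and dimensions over the complex field are those of the
   interpretation "vec" with scalar multiplication "*s"; the unqualified
   "subspace", "span" and "dim" on complex ^ 'm are the real ones. *)
definition plane_generated_by :: "complex set \<Rightarrow> (complex ^ 'm) set \<Rightarrow> bool" where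
  "plane_generated_by A W \<longleftrightarrow>
     vec.subspace W \<and> vec.dim W = 2 \<and>
     (\<exists>u v. (\<forall>i. u $ i \<in> A) \<and> (\<forall>i. v $ i \<in> A) \<and> W = vec.span {u, v})"

end

theory Submission
  imports Defs
begin

text \<open>
  Index the planes by vectors \<open>x\<close> of \<open>m - 2\<close> roots of unity, grouped into pairs \<open>(p, q)\<close>, and let
  the plane of \<open>x\<close> be generated by \<open>(1, 1, x)\<close> and \<open>(1, -1, M x)\<close>, where \<open>M\<close> maps each pair
  \<open>(p, q)\<close> to \<open>(q, p q)\<close>. Modulo 2 the exponent matrix of \<open>M\<close> generates the field with four
  elements, so neither it nor its difference to the identity is singular.
  The first two coordinates of a vector common to the planes of \<open>x\<close> and \<open>y\<close> show that its
  coefficients with respect to both bases agree, so it is enough that \<open>x - y\<close> and \<open>M x - M y\<close>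
  are linearly independent, that is, that
  \<open>(p - p') (p q - p' q') \<noteq> (q - q')\<^sup>2\<close> whenever \<open>(p, q) \<noteq> (p', q')\<close>.
  Otherwise, put \<open>p / p' = g\<^sup>a\<close> and \<open>q / q' = g\<^sup>b\<close> and divide by \<open>(g - 1)\<^sup>2\<close>. An integral relation
  between roots of unity of order a power of two remains valid modulo 2 when all of them are
  replaced by 1, whence \<open>a (a + b) \<equiv> b\<^sup>2\<close> modulo 2. So \<open>a\<close> and \<open>b\<close> are even, and one descends
  from \<open>g\<close> to \<open>g\<^sup>2\<close>.
\<close>

section \<open>Integral relations between roots of unity\<close>

text \<open>Relations are kept as polynomials over the integers, so that the value at 1 has a
  parity.\<close>

abbreviation ieval :: "int poly \<Rightarrow> complex \<Rightarrow> complex" where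
  "ieval P z \<equiv> poly (map_poly of_int P) z"

lemma ieval_add: "ieval (P + Q) z = ieval P z + ieval Q z"
proof -
  have "map_poly of_int (P + Q) = (map_poly of_int P + map_poly of_int Q :: complex poly)"
    by (rule poly_eqI) (simp add: coeff_map_poly)
  then show ?thesis by simp
qed

lemma ieval_diff: "ieval (P - Q) z = ieval P z - ieval Q z"
proof -
  have "map_poly of_int (P - Q) = (map_poly of_int P - map_poly of_int Q :: complex poly)"
    by (rule poly_eqI) (simp add: coeff_map_poly)
  then show ?thesis by simp
qed

lemma ieval_mult: "ieval (P * Q) z = ieval P z * ieval Q z"
proof -
  have "map_poly of_int (P * Q) = (map_poly of_int P * map_poly of_int Q :: complex poly)"
    by (rule poly_eqI) (simp add: coeff_map_poly coeff_mult)
  then show ?thesis by simp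
qed

lemma ieval_power: "ieval (P ^ n) z = ieval P z ^ n"
  by (induction n) (simp_all add: ieval_mult)

lemma ieval_sum: "ieval (\<Sum>i\<in>I. f i) z = (\<Sum>i\<in>I. ieval (f i) z)"
  by (induction I rule: infinite_finite_induct) (simp_all add: ieval_add)

lemma ieval_monom: "ieval (monom 1 n) z = z ^ n"
  by (simp add: map_poly_monom poly_monom)

lemma ieval_pCons: "ieval (pCons c P) z = of_int c + z * ieval P z"
  by (simp add: map_poly_pCons)

lemma ieval_1: "ieval P 1 = of_int (poly P 1)"
  by (induction P) (simp_all add: map_poly_pCons)

text \<open>Sorting the terms by the parity of their exponents prepares the passage from
  \<open>z\<close> to its square.\<close>

lemma even_odd_parts:
  "\<exists>E D. (\<forall>z. ieval P z = ieval E (z\<^sup>2) + z * ieval D (z\<^sup>2)) \<and>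
         poly P 1 = poly E 1 + poly D (1 :: int)"
proof (induction P)
  case 0
  show ?case by (intro exI[of _ 0]) simp
next
  case (pCons c P)
  then obtain E D where "\<And>z. ieval P z = ieval E (z\<^sup>2) + z * ieval D (z\<^sup>2)"
    and "poly P 1 = poly E 1 + poly D 1" by blast
  then show ?case
    by (intro exI[of _ "pCons c D"] exI[of _ E])
       (simp add: ieval_pCons algebra_simps power2_eq_square)
qed

text \<open>Squaring \<open>z\<close> lowers \<open>r\<close> by one, down to \<open>z = 1\<close>,
  where \<open>P\<close> itself vanishes at 1. The relation for the square must keep the parity of
  the value at 1.\<close>

lemma even_poly_1_if_root:
  assumes "z ^ 2 ^ r = 1" "ieval P z = 0"
  shows "even (poly P 1)"
  using assms
proof (induction r arbitrary: z P)
  case 0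
  then show ?case by (simp add: ieval_1)
next
  case (Suc r)
  obtain E D where ED: "\<And>z. ieval P z = ieval E (z\<^sup>2) + z * ieval D (z\<^sup>2)"
    and P1: "poly P 1 = poly E 1 + poly D 1"
    using even_odd_parts by blast
  \<comment> \<open>This is P(z) P(-z) as a polynomial in z^2; its value at 1 is E(1)^2 - D(1)^2,
    which has the parity of E(1) + D(1).\<close>
  define Q where "Q = E\<^sup>2 - monom 1 1 * D\<^sup>2"
  have "ieval Q (z\<^sup>2) = (ieval E (z\<^sup>2) + z * ieval D (z\<^sup>2)) * (ieval E (z\<^sup>2) - z * ieval D (z\<^sup>2))"
    by (simp add: Q_def ieval_diff ieval_mult ieval_power ieval_monom)
       (simp add: algebra_simps power2_eq_square)
  also have "\<dots> = 0"
    using Suc.prems(2) ED[of z] by simp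
  finally have "ieval Q (z\<^sup>2) = 0" .
  moreover have "(z\<^sup>2) ^ 2 ^ r = 1"
    using Suc.prems(1) by (simp flip: power_mult)
  ultimately have "even (poly Q 1)"
    by (rule Suc.IH[rotated])
  then show ?case
    by (simp add: Q_def P1 poly_monom)
qed

lemma geometric_factor: "(g::complex) ^ n - 1 = (g - 1) * (\<Sum>i<n. g ^ i)"
  by (rule power_diff_1_eq)

text \<open>After division by (g - 1)^2, replacing the roots by 1 leaves a (a + b) - b^2, which is
  odd unless \<open>a\<close> and \<open>b\<close> are both even.\<close>

lemma exponents_even:
  fixes z g :: complex
  assumes z: "z ^ 2 ^ r = 1" and g: "g = z ^ d" "g \<noteq> 1"
    and eq: "z ^ c * ((g ^ a - 1) * (g ^ (a + b) - 1)) = (g ^ b - 1)\<^sup>2"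
  shows "even a \<and> even b"
proof -
  \<comment> \<open>\<open>S n\<close> represents (g^n - 1) / (g - 1) as an integral polynomial in
    \<open>z\<close>.\<close>
  define S where "S n = (\<Sum>i<n. monom 1 (d * i) :: int poly)" for n
  have S: "ieval (S n) z = (\<Sum>i<n. g ^ i)" for n
    by (simp add: S_def ieval_sum ieval_monom g power_mult)
  have S1: "poly (S n) 1 = int n" for n
    by (simp add: S_def poly_sum poly_monom)
  define P where "P = monom 1 c * (S a * S (a + b)) - (S b)\<^sup>2"
  have "(g - 1)\<^sup>2 * ieval P z = z ^ c * ((g ^ a - 1) * (g ^ (a + b) - 1)) - (g ^ b - 1)\<^sup>2"
    unfolding P_def ieval_diff ieval_mult ieval_power ieval_monom S geometric_factor
    by (simp add: algebra_simps power2_eq_square)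
  then have "ieval P z = 0"
    using eq g by simp
  then have "even (poly P 1)"
    by (rule even_poly_1_if_root[OF z])
  then show ?thesis
    by (auto simp: P_def S1 poly_monom)
qed

text \<open>Doubling \<open>d\<close> halves \<open>a\<close> and \<open>b\<close> and lowers
  \<open>s\<close>. The root \<open>z\<close> stays fixed, so that the factor \<open>z ^ c\<close>
  remains a power of it.\<close>

lemma descent:
  fixes z :: complex
  assumes "z ^ 2 ^ r = 1" "(z ^ d) ^ 2 ^ s = 1"
    and "z ^ c * (((z ^ d) ^ a - 1) * ((z ^ d) ^ (a + b) - 1)) = ((z ^ d) ^ b - 1)\<^sup>2"
  shows "(z ^ d) ^ a = 1 \<and> (z ^ d) ^ b = 1"
  using assms(2,3)
proof (induction s arbitrary: d a b)
  case 0
  then show ?case by simp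
next
  case (Suc s)
  show ?case
  proof (cases "z ^ d = 1")
    case False
    then have "even a \<and> even b"
      using exponents_even[OF assms(1) refl _ Suc.prems(2)] by blast
    then obtain a' b' where ab: "a = 2 * a'" "b = 2 * b'" by blast
    have sq: "(z ^ d) ^ (2 * n) = (z ^ (d * 2)) ^ n" for n
      by (simp add: power_mult)
    have "(z ^ (d * 2)) ^ 2 ^ s = 1"
      using Suc.prems(1) by (simp add: sq)
    moreover have "z ^ c * (((z ^ (d * 2)) ^ a' - 1) * ((z ^ (d * 2)) ^ (a' + b') - 1)) =
        ((z ^ (d * 2)) ^ b' - 1)\<^sup>2"
      using Suc.prems(2) unfolding ab by (simp only: sq flip: distrib_left)
    ultimately show ?thesis
      unfolding ab sq by (rule Suc.IH)
  qed simp
qed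

section \<open>The roots of unity of order a power of two\<close>

lemma pow2_roots_eq: "pow2_roots r = {z. z ^ 2 ^ r = 1}"
  using complex_roots_unity[of "2 ^ r"] by (simp add: pow2_roots_def)

lemma card_pow2_roots: "card (pow2_roots r) = 2 ^ r"
  using card_complex_roots_unity[of "2 ^ r"] by (simp add: pow2_roots_eq)

lemma finite_pow2_roots: "finite (pow2_roots r)"
  by (rule card_ge_0_finite) (simp add: card_pow2_roots)

lemma pow2_roots_nonzero: "p \<in> pow2_roots r \<Longrightarrow> p \<noteq> 0"
  by (auto simp: pow2_roots_eq power_0_left)

lemma pow2_roots_mult: "p \<in> pow2_roots r \<Longrightarrow> q \<in> pow2_roots r \<Longrightarrow> p * q \<in> pow2_roots r"
  by (simp add: pow2_roots_eq power_mult_distrib)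

lemma pow2_roots_divide: "p \<in> pow2_roots r \<Longrightarrow> q \<in> pow2_roots r \<Longrightarrow> p / q \<in> pow2_roots r"
  by (simp add: pow2_roots_eq power_divide)

lemma pow2_roots_1: "1 \<in> pow2_roots r"
  by (simp add: pow2_roots_eq)

lemma pow2_roots_minus_1: "r \<ge> 1 \<Longrightarrow> -1 \<in> pow2_roots r"
  by (simp add: pow2_roots_eq)

lemma pow2_roots_generator:
  obtains z where "z ^ 2 ^ r = 1" "\<And>p. p \<in> pow2_roots r \<Longrightarrow> \<exists>k. p = z ^ k"
proof
  let ?z = "exp (2 * of_real pi * \<i> / 2 ^ r) :: complex"
  have pow: "?z ^ k = exp (2 * of_real pi * \<i> * of_nat k / 2 ^ r)" for k
    by (simp add: mult_ac flip: exp_of_nat_mult)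
  show "?z ^ 2 ^ r = 1"
    by (simp add: pow)
  show "\<exists>k. p = ?z ^ k" if "p \<in> pow2_roots r" for p
    using that by (auto simp: pow2_roots_def pow)
qed

lemma pair_determinant_eq_0:
  assumes mem: "p \<in> pow2_roots r" "q \<in> pow2_roots r" "p' \<in> pow2_roots r" "q' \<in> pow2_roots r"
    and eq: "(p - p') * (p * q - p' * q') = (q - q')\<^sup>2"
  shows "p = p' \<and> q = q'"
proof -
  obtain z where z: "z ^ 2 ^ r = 1" and gen: "\<And>p. p \<in> pow2_roots r \<Longrightarrow> \<exists>k. p = z ^ k"
    using pow2_roots_generator by metis
  have nz: "p' \<noteq> 0" "q' \<noteq> 0"
    using mem pow2_roots_nonzero by blast+
  obtain a where a: "p / p' = z ^ a"
    using gen[OF pow2_roots_divide[OF mem(1,3)]] by blast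
  obtain b where b: "q / q' = z ^ b"
    using gen[OF pow2_roots_divide[OF mem(2,4)]] by blast
  \<comment> \<open>This factor remains when p'^2 q', taken out of the left side, is divided by
    q'^2.\<close>
  obtain c where c: "p' * p' / q' = z ^ c"
    using gen[OF pow2_roots_divide[OF pow2_roots_mult[OF mem(3,3)] mem(4)]] by blast
  have p: "p = p' * z ^ a" and q: "q = q' * z ^ b"
    using a b nz by (simp_all add: field_simps)
  have "q'\<^sup>2 * (z ^ c * ((z ^ a - 1) * (z ^ (a + b) - 1))) = (p - p') * (p * q - p' * q')"
    unfolding p q c[symmetric] using nz by (simp add: field_simps power2_eq_square power_add)
  also note eq
  also have "(q - q')\<^sup>2 = q'\<^sup>2 * (z ^ b - 1)\<^sup>2"
    unfolding q by (simp add: algebra_simps power2_eq_square)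
  finally have "z ^ c * ((z ^ a - 1) * (z ^ (a + b) - 1)) = (z ^ b - 1)\<^sup>2"
    using nz by simp
  then have "z ^ a = 1 \<and> z ^ b = 1"
    using descent[of z r 1 r c a b] z by simp
  then show ?thesis
    by (simp add: p q)
qed

section \<open>The planes\<close>

lemma mem_vec_span_pair:
  fixes u v w :: "complex ^ 'm"
  shows "w \<in> vec.span {u, v} \<longleftrightarrow> (\<exists>\<alpha> \<beta>. w = \<alpha> *s u + \<beta> *s v)"
proof -
  have "w - \<alpha> *s u - \<beta> *s v = 0 \<longleftrightarrow> w = \<alpha> *s u + \<beta> *s v" for \<alpha> \<beta>
    by (simp add: algebra_simps)
  then show ?thesis
    by (simp add: vec.span_breakdown_eq)
qed

text \<open>Two halves of equal size are in bijection; this pairs off the coordinates other than the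
  two special ones.\<close>

lemma even_card_obtain_pairing:
  assumes "finite S" "even (card S)"
  obtains F t where "F \<subseteq> S" "bij_betw t F (S - F)"
proof -
  obtain F where F: "F \<subseteq> S" "card F = card S div 2" "finite F"
    using obtain_subset_with_card_n[of "card S div 2" S] by auto
  have "card F = card (S - F)"
    using F assms by (auto simp: card_Diff_subset)
  then show thesis
    using F assms finite_same_card_bij[of F "S - F"] that by auto
qed

theorem theorem4p2:
  fixes r :: nat
  assumes "r \<ge> 1"
    and "CARD('m::finite) \<ge> 2"
    and "even CARD('m)"
  shows "card (pow2_roots r) ^ (CARD('m) - 2) = 2 ^ ((CARD('m) - 2) * r) \<and>
    (\<exists>\<W> :: (complex ^ 'm) set set.
       finite \<W> \<and> card \<W> = card (pow2_roots r) ^ (CARD('m) - 2) \<and>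
       (\<forall>W \<in> \<W>. plane_generated_by (pow2_roots r) W) \<and>
       (\<forall>W \<in> \<W>. \<forall>W' \<in> \<W>. W \<noteq> W' \<longrightarrow> W \<inter> W' = {0}))"
proof -
  let ?A = "pow2_roots r"
  obtain T :: "'m set" where "card T = 2"
    using obtain_subset_with_card_n[of 2 "UNIV :: 'm set"] assms(2) by auto
  then obtain i1 i2 :: 'm where i12: "i1 \<noteq> i2"
    by (auto simp: card_2_iff)
  define S where "S = UNIV - {i1, i2}"
  have card_S: "card S = CARD('m) - 2"
    using i12 by (simp add: S_def card_Diff_subset)
  obtain F t where F: "F \<subseteq> S" and t: "bij_betw t F (S - F)"
    using even_card_obtain_pairing[of S] assms(2,3) card_S by auto
  define t' where "t' = inv_into F t"
  have t_in: "t i \<in> S - F" and t't: "t' (t i) = i" if "i \<in> F" for i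
    using t that by (auto simp: t'_def bij_betw_def)
  have t'_in: "t' i \<in> F" and tt': "t (t' i) = i" if "i \<in> S - F" for i
    using t that by (auto simp: t'_def bij_betw_def inv_into_into f_inv_into_f)
  \<comment> \<open>A pair (p, q) occupies the coordinates \<open>i\<close> in \<open>F\<close> and
    \<open>t i\<close>, where \<open>M\<close> has the entries q and p q.\<close>
  define M where "M x i = (if i \<in> F then x (t i) else x (t' i) * x i)" for x :: "'m \<Rightarrow> complex" and i
  define u where "u x = (\<chi> i. if i \<in> S then x i else 1)" for x :: "'m \<Rightarrow> complex"
  \<comment> \<open>The signs at \<open>i1\<close> and \<open>i2\<close> keep \<open>v x\<close>
    from being proportional to \<open>u x\<close>, whatever \<open>x\<close> is.\<close>
  define v where "v x = (\<chi> i. if i \<in> S then M x i else if i = i1 then 1 else -1)"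
    for x :: "'m \<Rightarrow> complex"
  \<comment> \<open>Extensionality makes distinct members of \<open>X\<close> differ somewhere on
    \<open>S\<close>.\<close>
  define X where "X = S \<rightarrow>\<^sub>E ?A"
  define V where "V x = vec.span {u x, v x}" for x
  have x_in: "x i \<in> ?A" if "x \<in> X" "i \<in> S" for x i
    using that by (auto simp: X_def)
  have M_in: "M x i \<in> ?A" if "x \<in> X" "i \<in> S" for x i
    using that t_in[of i] subsetD[OF F t'_in[of i]] x_in
    by (auto simp: M_def intro!: pow2_roots_mult)
  have u_in: "u x $ i \<in> ?A" and v_in: "v x $ i \<in> ?A" if "x \<in> X" for x i
    using that x_in M_in pow2_roots_1 pow2_roots_minus_1[OF assms(1)]
    by (auto simp: u_def v_def)
  have i12_S: "i1 \<notin> S" "i2 \<notin> S" by (auto simp: S_def)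
  have uv_i1: "u x $ i1 = 1" "v x $ i1 = 1" and uv_i2: "u x $ i2 = 1" "v x $ i2 = -1" for x
    using i12 i12_S by (auto simp: u_def v_def)
  have uv_S: "u x $ i = x i" "v x $ i = M x i" if "i \<in> S" for x i
    using that by (auto simp: u_def v_def)

  have plane: "plane_generated_by ?A (V x)" if "x \<in> X" for x
  proof -
    have ne: "u x \<noteq> k *s v x" for k
    proof
      assume "u x = k *s v x"
      then have "u x $ i1 = (k *s v x) $ i1" "u x $ i2 = (k *s v x) $ i2" by simp_all
      then show False by (simp add: uv_i1 uv_i2)
    qed
    have "v x $ i1 \<noteq> 0 $ i1" by (simp add: uv_i1)
    then have "v x \<noteq> 0" by metis
    then have "vec.independent {u x, v x}" "u x \<noteq> v x"
      using ne ne[of 1] by (auto simp: vec.independent_insert vec.span_singleton)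
    then have "vec.dim (V x) = 2"
      by (simp add: V_def vec.dim_eq_card_independent)
    then show ?thesis
      using u_in[OF that] v_in[OF that]
      unfolding plane_generated_by_def V_def by (blast intro: vec.subspace_span)
  qed

  have trivial: "V x \<inter> V y = {0}" if xy: "x \<in> X" "y \<in> X" "x \<noteq> y" for x y
  proof -
    have "w = 0" if w: "w \<in> V x" "w \<in> V y" for w
    proof -
      obtain \<alpha> \<beta> where w1: "w = \<alpha> *s u x + \<beta> *s v x"
        using w(1) by (auto simp: V_def mem_vec_span_pair)
      obtain \<gamma> \<delta> where w2: "w = \<gamma> *s u y + \<delta> *s v y"
        using w(2) by (auto simp: V_def mem_vec_span_pair)
      have coord: "\<alpha> * u x $ i + \<beta> * v x $ i = \<gamma> * u y $ i + \<delta> * v y $ i" for i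
        using arg_cong[OF trans[OF w1[symmetric] w2], of "\<lambda>w. w $ i"] by simp
      have sum: "\<alpha> + \<beta> = \<gamma> + \<delta>" and diff: "\<alpha> - \<beta> = \<gamma> - \<delta>"
        using coord[of i1] coord[of i2] by (simp_all add: uv_i1 uv_i2)
      have "2 * \<alpha> = \<alpha> + \<beta> + (\<alpha> - \<beta>)" by simp
      also have "\<dots> = 2 * \<gamma>" unfolding sum diff by simp
      finally have same: "\<gamma> = \<alpha>" "\<delta> = \<beta>"
        using sum by simp_all
      have rel: "\<alpha> * (x i - y i) + \<beta> * (M x i - M y i) = 0" if "i \<in> S" for i
        using coord[of i] that by (simp add: uv_S same algebra_simps)
      obtain j where j: "j \<in> S" "x j \<noteq> y j"
        using xy PiE_ext[of x S "\<lambda>_. ?A" y] by (auto simp: X_def)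
      \<comment> \<open>The first coordinate of the pair that contains \<open>j\<close>.\<close>
      define i where "i = (if j \<in> F then j else t' j)"
      have i: "i \<in> F"
        using j t'_in by (auto simp: i_def)
      have neq: "x i \<noteq> y i \<or> x (t i) \<noteq> y (t i)"
        using j tt' by (auto simp: i_def)
      have S: "i \<in> S" "t i \<in> S" "t i \<notin> F"
        using i F t_in by auto
      define p q p' q' where "p = x i" "q = x (t i)" "p' = y i" "q' = y (t i)"
      note pq = this
      have 1: "\<alpha> * (p - p') + \<beta> * (q - q') = 0"
        using rel[OF S(1)] i by (simp add: M_def pq)
      have 2: "\<alpha> * (q - q') + \<beta> * (p * q - p' * q') = 0"
        using rel[OF S(2)] i S(3) by (simp add: M_def pq t't)
      have det: "(p - p') * (p * q - p' * q') - (q - q')\<^sup>2 \<noteq> 0"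
        using pair_determinant_eq_0[of p r q p' q'] neq x_in xy S by (auto simp: pq)
      \<comment> \<open>Cramer's rule for the 2 by 2 system in \<alpha> and \<beta>.\<close>
      have "\<alpha> * ((p - p') * (p * q - p' * q') - (q - q')\<^sup>2) =
          (p * q - p' * q') * (\<alpha> * (p - p') + \<beta> * (q - q')) -
          (q - q') * (\<alpha> * (q - q') + \<beta> * (p * q - p' * q'))"
        by (simp add: algebra_simps power2_eq_square)
      then have "\<alpha> = 0"
        unfolding 1 2 using det by simp
      have "\<beta> * ((p - p') * (p * q - p' * q') - (q - q')\<^sup>2) =
          (p - p') * (\<alpha> * (q - q') + \<beta> * (p * q - p' * q')) -
          (q - q') * (\<alpha> * (p - p') + \<beta> * (q - q'))"
        by (simp add: algebra_simps power2_eq_square)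
      then have "\<beta> = 0"
        unfolding 1 2 using det by simp
      with \<open>\<alpha> = 0\<close> show "w = 0" by (simp add: w1)
    qed
    then show ?thesis
      by (auto simp: V_def vec.span_zero)
  qed

  \<comment> \<open>If two indices gave the same plane, it would be its own trivial intersection,
    yet it contains the nonzero \<open>u x\<close>.\<close>
  have "inj_on V X"
  proof (rule inj_onI, rule ccontr)
    fix x y assume xy: "x \<in> X" "y \<in> X" "V x = V y" "x \<noteq> y"
    have "u x \<in> V x" by (auto simp: V_def intro: vec.span_base)
    then have "u x = 0" using trivial xy by blast
    then have "u x $ i1 = 0" by simp
    then show False by (simp add: uv_i1)
  qed
  then have card_V: "card (V ` X) = card ?A ^ (CARD('m) - 2)"
    by (simp add: card_image X_def card_PiE card_S)
  moreover have "finite (V ` X)"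
    unfolding X_def by (intro finite_imageI finite_PiE finite_pow2_roots) simp
  moreover have "card ?A ^ (CARD('m) - 2) = 2 ^ ((CARD('m) - 2) * r)"
    by (simp add: card_pow2_roots mult.commute flip: power_mult)
  ultimately show ?thesis
    using plane trivial by (intro conjI exI[of _ "V ` X"]) auto
qed

end
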